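(* Let $(S,\cdot,\leq)$ be an ordered semigroup and let $m\geq 1$ be an integer. Then $S$ is $m$-regular if and only if $B\cap I\cap L\subseteq (BIL]$ for every $m$-bi-interior ideal $B$, every $m$-ideal $I$ and every $m$-left ideal $L$ of $S$.
   Context: An ordered semigroup $(S,\cdot,\leq)$ is a semigroup with a partial order such that $a\leq b$ implies $xa\leq xb$ and $ax\leq bx$ for all $a,b,x\in S$. For $A,B\subseteq S$, $AB=\{ab: a\in A, b\in B\}$ (with $a$ in place of $\{a\}$), and $S^m=S\cdots S$ ($m$ factors) is the set of all products of $m$ elements of $S$. For $H\subseteq S$, $(H]=\{t\in S: t\leq h \text{ for some } h\in H\}$. Subsemigroups are understood to be non-empty. - $S$ is $m$-regular if $a\in(aS^ma]$ for all $a\in S$, i.e. for every $a\in S$ there is $x\in S^m$ with $a\leq axa$. - An $m$-left ideal of $S$ is a subsemigroup $L$ of $S$ with $S^mL\subseteq L$ and $(L]=L$; an $m$-right ideal is a subsemigroup $R$ with $RS^m\subseteq R$ and $(R]=R$; an $m$-ideal is a subsemigroup that is both an $m$-left and an $m$-right ideal. - An $m$-bi-interior ideal is a non-empty subset $B$ of $S$ (not required to be a subsemigroup) with $(BS^mB]\cap(S^mBS^m]\subseteq B$ and $(B]=B$. *)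

theory Defs
  imports "HOL-Library.Set_Algebras"
begin

class ordered_semigroup = semigroup_mult + order +
  assumes mult_left_mono_os: "a \<le> b \<Longrightarrow> x * a \<le> x * b"
    and mult_right_mono_os: "a \<le> b \<Longrightarrow> a * x \<le> b * x"

text \<open>
  Products of subsets are the elementwise ones of \<^theory>\<open>HOL-Library.Set_Algebras\<close>.
  The power is defined by hand because a semigroup need not have a unit; the exponent 0 has no
  meaning and gets a dummy value.
\<close>

fun set_power :: "'a::semigroup_mult set \<Rightarrow> nat \<Rightarrow> 'a set" where
  "set_power A 0 = {}"
| "set_power A (Suc 0) = A"
| "set_power A (Suc (Suc n)) = A * set_power A (Suc n)"

text \<open>The set \<open>(H]\<close>.\<close>

definition down :: "'a::ord set \<Rightarrow> 'a set" where
  "down H = {t. \<exists>h\<in>H. t \<le> h}"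

definition subsemigroup :: "'a::semigroup_mult set \<Rightarrow> bool" where
  "subsemigroup T \<longleftrightarrow> T \<noteq> {} \<and> T * T \<subseteq> T"

text \<open>The semigroup \<open>S\<close> is the whole type, i.e. \<open>S = UNIV\<close>.\<close>

definition m_regular :: "'a::ordered_semigroup itself \<Rightarrow> nat \<Rightarrow> bool" where
  "m_regular _ m \<longleftrightarrow> (\<forall>a::'a. a \<in> down ({a} * set_power UNIV m * {a}))"

definition m_left_ideal :: "nat \<Rightarrow> 'a::ordered_semigroup set \<Rightarrow> bool" where
  "m_left_ideal m L \<longleftrightarrow> subsemigroup L \<and> set_power UNIV m * L \<subseteq> L \<and> down L = L"

definition m_right_ideal :: "nat \<Rightarrow> 'a::ordered_semigroup set \<Rightarrow> bool" where
  "m_right_ideal m R \<longleftrightarrow> subsemigroup R \<and> R * set_power UNIV m \<subseteq> R \<and> down R = R"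

definition m_ideal :: "nat \<Rightarrow> 'a::ordered_semigroup set \<Rightarrow> bool" where
  "m_ideal m I \<longleftrightarrow> m_left_ideal m I \<and> m_right_ideal m I"

definition m_bi_interior_ideal :: "nat \<Rightarrow> 'a::ordered_semigroup set \<Rightarrow> bool" where
  "m_bi_interior_ideal m B \<longleftrightarrow>
     B \<noteq> {} \<and>
     down (B * set_power UNIV m * B) \<inter> down (set_power UNIV m * B * set_power UNIV m) \<subseteq> B \<and>
     down B = B"

end

theory Submission
  imports Defs
begin

text \<open>
  If \<open>a \<le> axa\<close> with \<open>x \<in> S\<^sup>m\<close>, then \<open>a \<le> a(xax)a\<close>, and \<open>xax\<close> lies in every \<open>m\<close>-ideal
  containing \<open>a\<close>. Conversely, take for \<open>B\<close> and \<open>L\<close> the ordinary principal right and left ideals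
  of \<open>a\<close>, and \<open>I = S\<close>; this gives \<open>a \<le> asa\<close> for some \<open>s \<in> S\<close>. Substituting this inequality into
  itself, \<open>a \<le> a(sas)a \<le> a(sasas)a \<le> \<dots>\<close>, makes the middle factor as long a product as needed.
\<close>

lemma down_idem: "down (down H) = down (H :: 'a::preorder set)"
  unfolding down_def by (auto intro: order_trans)

text \<open>The element \<open>a\<close> is adjoined explicitly: without a unit it need not lie
  below any element of \<open>{a} * UNIV\<close>.\<close>

definition principal_right :: "'a::ordered_semigroup \<Rightarrow> 'a set" where
  "principal_right a = down (insert a ({a} * UNIV))"

definition principal_left :: "'a::ordered_semigroup \<Rightarrow> 'a set" where
  "principal_left a = down (insert a (UNIV * {a}))"

lemma mem_principal_right: "t \<in> principal_right a \<longleftrightarrow> t \<le> a \<or> (\<exists>u. t \<le> a * u)"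
  by (auto simp: principal_right_def down_def set_times_def)

lemma mem_principal_left: "t \<in> principal_left a \<longleftrightarrow> t \<le> a \<or> (\<exists>u. t \<le> u * a)"
  by (auto simp: principal_left_def down_def set_times_def)

lemma principal_right_mult: "t \<in> principal_right a \<Longrightarrow> t * x \<in> principal_right a"
  unfolding mem_principal_right by (metis mult.assoc mult_right_mono_os)

lemma principal_left_mult: "t \<in> principal_left a \<Longrightarrow> x * t \<in> principal_left a"
  unfolding mem_principal_left by (metis mult.assoc mult_left_mono_os)

text \<open>A product whose first factor lies in a right ideal stays there, so it suffices to bound
  the first of the two intersected sets.\<close>

lemma m_bi_interior_ideal_principal_right: "m_bi_interior_ideal m (principal_right a)"
proof -
  have closed: "down (principal_right a) = principal_right a"
    by (simp add: principal_right_def down_idem)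
  have "principal_right a * set_power UNIV m * principal_right a \<subseteq> principal_right a"
    by (auto elim!: set_times_elim intro: principal_right_mult)
  then have "down (principal_right a * set_power UNIV m * principal_right a) \<subseteq> principal_right a"
    using closed by (auto simp: down_def)
  moreover have "a \<in> principal_right a"
    by (simp add: mem_principal_right)
  ultimately show ?thesis
    using closed by (auto simp: m_bi_interior_ideal_def)
qed

lemma m_left_ideal_principal_left: "m_left_ideal m (principal_left a)"
proof -
  have "a \<in> principal_left a"
    by (simp add: mem_principal_left)
  moreover have "down (principal_left a) = principal_left a"
    by (simp add: principal_left_def down_idem)
  ultimately show ?thesis
    by (auto simp: m_left_ideal_def subsemigroup_def elim!: set_times_elim intro: principal_left_mult)
qed

lemma m_ideal_UNIV: "m_ideal m UNIV"
  by (auto simp: m_ideal_def m_left_ideal_def m_right_ideal_def subsemigroup_def down_def)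

lemma mem_down_sandwich:
  "a \<in> down ({a} * X * {a}) \<longleftrightarrow> (\<exists>x\<in>X. a \<le> a * x * a)"
  by (auto simp: down_def set_times_def)

lemma ex_set_power_sandwich:
  fixes a s :: "'a::ordered_semigroup"
  assumes "a \<le> a * s * a" "m \<ge> 1"
  shows "\<exists>x\<in>set_power UNIV m. a \<le> a * x * a"
  using \<open>m \<ge> 1\<close>
proof (induction m rule: dec_induct)
  case base
  then show ?case using assms(1) by auto
next
  case (step n)
  then obtain x where x: "x \<in> set_power UNIV n" "a \<le> a * x * a"
    by blast
  have "a * s * a \<le> a * s * (a * x * a)"
    by (rule mult_left_mono_os) (rule x(2))
  then have "a \<le> a * (s * a * x) * a"
    using assms(1) by (simp add: mult.assoc)
  \<comment> \<open>Bracketed as \<open>(s * a) * x\<close>, this adds to \<open>x\<close> the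
    single factor \<open>s * a\<close>, so the length grows by exactly one. Splitting
    \<open>n\<close> exposes the successor needed to unfold \<open>set_power\<close>; the case 0 is
    contradictory.\<close>
  moreover have "s * a * x \<in> set_power UNIV (Suc n)"
    using x(1) step(1) by (cases n) (auto intro: set_times_intro)
  ultimately show ?case by blast
qed

theorem theorem2p7:
  fixes m :: nat
  assumes "m \<ge> 1"
  shows "m_regular TYPE('a::ordered_semigroup) m \<longleftrightarrow>
    (\<forall>B I L :: 'a set. m_bi_interior_ideal m B \<longrightarrow> m_ideal m I \<longrightarrow> m_left_ideal m L \<longrightarrow>
       B \<inter> I \<inter> L \<subseteq> down (B * I * L))"
    (is "?reg \<longleftrightarrow> ?incl")
proof
  assume ?reg
  show ?incl
  proof (intro allI impI subsetI)
    fix B I L :: "'a set" and a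
    assume I: "m_ideal m I" and a: "a \<in> B \<inter> I \<inter> L"
    obtain x where x: "x \<in> set_power UNIV m" "a \<le> a * x * a"
      using \<open>?reg\<close> unfolding m_regular_def mem_down_sandwich by blast
    \<comment> \<open>\<open>I\<close> absorbs elements of \<open>S^m\<close>, not arbitrary ones,
      so \<open>x\<close> is multiplied on as a whole, first on the left, then on the right.\<close>
    have "x * a \<in> I"
      using I x(1) a by (auto simp: m_ideal_def m_left_ideal_def intro: set_times_intro)
    then have "x * a * x \<in> I"
      using I x(1) by (auto simp: m_ideal_def m_right_ideal_def intro: set_times_intro)
    then have "a * (x * a * x) * a \<in> B * I * L"
      using a by (auto intro: set_times_intro)
    moreover have "a * x * a \<le> a * x * (a * x * a)"
      by (rule mult_left_mono_os) (rule x(2))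
    then have "a \<le> a * (x * a * x) * a"
      using x(2) by (simp add: mult.assoc)
    ultimately show "a \<in> down (B * I * L)"
      by (auto simp: down_def)
  qed
next
  assume ?incl
  have "a \<in> down ({a} * set_power UNIV m * {a})" for a :: 'a
  proof -
    have "a \<in> principal_right a \<inter> UNIV \<inter> principal_left a"
      by (simp add: mem_principal_right mem_principal_left)
    then have "a \<in> down (principal_right a * UNIV * principal_left a)"
      using \<open>?incl\<close> m_bi_interior_ideal_principal_right m_ideal_UNIV m_left_ideal_principal_left
      by blast
    then obtain b i l where b: "b \<in> principal_right a" and l: "l \<in> principal_left a"
      and le: "a \<le> b * i * l"
      by (auto simp: down_def elim!: set_times_elim)
    \<comment> \<open>If \<open>b \<le> a\<close>, take \<open>u = i\<close>; if
      \<open>b \<le> a * v\<close>, take \<open>u = v * i\<close>. The factor \<open>i\<close> lets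
      both cases end in the form \<open>a * u\<close>.\<close>
    obtain u where u: "b * i \<le> a * u"
      using b unfolding mem_principal_right by (metis mult.assoc mult_right_mono_os)
    \<comment> \<open>Likewise \<open>s = u\<close> if \<open>l \<le> a\<close>, and
      \<open>s = u * v\<close> if \<open>l \<le> v * a\<close>.\<close>
    have "\<exists>s. a * u * l \<le> a * s * a"
      using l unfolding mem_principal_left by (metis mult.assoc mult_left_mono_os)
    then obtain s where "a * u * l \<le> a * s * a" ..
    then have "a \<le> a * s * a"
      using le mult_right_mono_os[OF u] by (meson order_trans)
    then show ?thesis
      using ex_set_power_sandwich assms by (simp add: mem_down_sandwich)
  qed
  then show ?reg
    by (simp add: m_regular_def)
qed

end
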